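(* Let $\mathbf{F}$ be a finite field with $q$ elements, $V$ a finite-dimensional $\mathbf{F}$-vector space, $W\subset V$ a subspace of codimension $1$, and $T\colon W\to V$ a linear map (a partial linear map on $V$ with domain $W$). For $j\ge0$ let $e(T,j)=\#\{S\colon V\to V\text{ semi-idempotent} : S|_W=T,\ \mathrm{srk}\,S=j\}$, and for $i,j\ge0$ let $e(T,i,j)=\#\{S\colon V\to V\text{ semi-idempotent}: S|_W=T,\ \operatorname{rank} S=i,\ \mathrm{srk}\,S=j\}$. Then (1) $e(T,\mathrm{srk}\,T)=q^{\mathrm{srk}\,T}\,e(T,\mathrm{srk}\,T+1)$; (2) if $\operatorname{im} T\not\subset W$, then $e(T,\operatorname{rank} T,\mathrm{srk}\,T)=q^{\mathrm{srk}\,T}\,e(T,\operatorname{rank} T,\mathrm{srk}\,T+1)$ and $e(T,\operatorname{rank} T+1,\mathrm{srk}\,T)=q^{\mathrm{srk}\,T}\,e(T,\operatorname{rank} T+1,\mathrm{srk}\,T+1)$.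
   Context: A partial linear map on $V$ is a linear map $T\colon W\to V$ from a subspace $W=\operatorname{dom}T$. The composite of partial linear maps $T,S$ has domain $S^{-1}(\operatorname{dom}T)$ and is $v\mapsto T(S(v))$; $T^0=\mathrm{id}_V$ and $T^j$ is the $j$-fold composite. The stable rank $\mathrm{srk}\,T$ of a partial linear map is $\dim \operatorname{im} T^j$ for $j\gg0$. A linear operator $S\colon V\to V$ is semi-idempotent if $V=X\oplus Y$ with $X,Y$ $S$-stable, $S|_X=\mathrm{id}$, $S|_Y$ nilpotent. *)

theory Defs
  imports "HOL-Analysis.Analysis"
begin

text \<open>The ambient finite-dimensional space V over the field 'a is modelled as 'a^'n.
  A partial linear map with domain W is a subspace W together with a function T
  that is linear on W (values of T outside W are irrelevant).\<close>

definition plinear :: "('a::field^'n) set \<Rightarrow> ('a^'n \<Rightarrow> 'a^'n) \<Rightarrow> bool" where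
  "plinear W T \<longleftrightarrow> vec.subspace W \<and>
     (\<forall>x\<in>W. \<forall>y\<in>W. T (x + y) = T x + T y) \<and>
     (\<forall>c. \<forall>x\<in>W. T (c *s x) = c *s T x)"

text \<open>Domain of the j-fold composite T^j: T^0 = id with domain V, and
  T^(j+1) = T o T^j has domain (T^j)^{-1}(W).\<close>

fun pdom :: "('a::field^'n) set \<Rightarrow> ('a^'n \<Rightarrow> 'a^'n) \<Rightarrow> nat \<Rightarrow> ('a^'n) set" where
  "pdom W T 0 = UNIV"
| "pdom W T (Suc j) = {v \<in> pdom W T j. (T ^^ j) v \<in> W}"

definition pimage :: "('a::field^'n) set \<Rightarrow> ('a^'n \<Rightarrow> 'a^'n) \<Rightarrow> nat \<Rightarrow> ('a^'n) set" where
  "pimage W T j = (T ^^ j) ` pdom W T j"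

text \<open>Stable rank: dim im T^j for all sufficiently large j.\<close>
definition srk :: "('a::field^'n) set \<Rightarrow> ('a^'n \<Rightarrow> 'a^'n) \<Rightarrow> nat" where
  "srk W T = (THE d. \<exists>N. \<forall>j\<ge>N. vec.dim (pimage W T j) = d)"

definition prank :: "('a::field^'n) set \<Rightarrow> ('a^'n \<Rightarrow> 'a^'n) \<Rightarrow> nat" where
  "prank W T = vec.dim (T ` W)"

definition semi_idempotent :: "('a::field^'n \<Rightarrow> 'a^'n) \<Rightarrow> bool" where
  "semi_idempotent S \<longleftrightarrow> (\<exists>X Y. vec.subspace X \<and> vec.subspace Y \<and>
      X \<inter> Y = {0} \<and> (\<forall>v. \<exists>x\<in>X. \<exists>y\<in>Y. v = x + y) \<and>
      S ` X \<subseteq> X \<and> S ` Y \<subseteq> Y \<and> (\<forall>x\<in>X. S x = x) \<and>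
      (\<exists>k. \<forall>y\<in>Y. (S ^^ k) y = 0))"

text \<open>e(T,j) and e(T,i,j): S ranges over linear operators V \<rightarrow> V.\<close>
definition e2 :: "('a::{field,finite}^'n) set \<Rightarrow> ('a^'n \<Rightarrow> 'a^'n) \<Rightarrow> nat \<Rightarrow> nat" where
  "e2 W T j = card {S. Vector_Spaces.linear (*s) (*s) S \<and> semi_idempotent S \<and>
      (\<forall>w\<in>W. S w = T w) \<and> srk UNIV S = j}"

definition e3 :: "('a::{field,finite}^'n) set \<Rightarrow> ('a^'n \<Rightarrow> 'a^'n) \<Rightarrow> nat \<Rightarrow> nat \<Rightarrow> nat" where
  "e3 W T i j = card {S. Vector_Spaces.linear (*s) (*s) S \<and> semi_idempotent S \<and>
      (\<forall>w\<in>W. S w = T w) \<and> prank UNIV S = i \<and> srk UNIV S = j}"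

end

(* Fix v0 outside W. A linear extension S of T is determined by u = S v0. Let D be the largest
   subspace of W on which all powers of T are defined, i.e. dom T^j for large j. If T has a
   semi-idempotent extension, then T restricted to D is semi-idempotent, D is the direct sum of its
   fixed space F and its nilpotent part Y, and srk T = dim F. Let m be the step at which the domains
   dom T^j stop shrinking, pick c in dom T^(m-1) but not in dom T^m, and take v0 = T^(m-1) c. Then D
   and the orbit of c span V, and every extension S satisfies S^m c = u. Comparing dimensions along
   the chain of preimages of an S-invariant subspace under the powers of S shows: S is
   semi-idempotent with srk S = srk T iff u is in D, and semi-idempotent with srk S = srk T + 1 iff
   u - v0 is in Y. Hence the two counts are |F| |Y| = q^(srk T) |Y| and |Y|. If im T is not inside W,
   then v0 lies in im T and rank S = rank T exactly when u lies in im T; since F is contained in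
   im T, the same count goes through after intersecting with im T or with its complement. *)

theory Submission imports Defs begin

section \<open>Iterates of linear operators\<close>

abbreviation vec_linear :: "('a::field^'n \<Rightarrow> 'a^'n) \<Rightarrow> bool" where
  "vec_linear f \<equiv> Vector_Spaces.linear (*s) (*s) f"

lemma vec_linear_funpow: "vec_linear S \<Longrightarrow> vec_linear (S ^^ k)"
  by (induction k) (simp_all add: vec.linear_id Vector_Spaces.linear_compose)

lemma vec_linearI:
  fixes f :: "'a::field^'n \<Rightarrow> 'a^'n"
  assumes "\<And>x y. f (x + y) = f x + f y" and "\<And>c x. f (c *s x) = c *s f x"
  shows "vec_linear f"
  unfolding Vector_Spaces.linear_iff using vec.vector_space_axioms assms by blast

lemma subspace_fixpoints:
  assumes "vec_linear S" shows "vec.subspace {x. S x = x}"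
  using vec.linear_subspace_kernel[OF vec.linear_compose_sub[OF assms vec.linear_id]] by simp

lemma funpow_eq_if_stable:
  fixes f :: "'b \<Rightarrow> 'b"
  assumes "f ^^ Suc N = f ^^ N" and "N \<le> j"
  shows "f ^^ j = f ^^ N"
proof -
  have "f ^^ (i + N) = f ^^ N" for i
  proof (induction i)
    case (Suc i)
    have "f ^^ (Suc i + N) = f ^^ i \<circ> f ^^ Suc N" by (simp only: add_Suc_shift funpow_add)
    also have "\<dots> = f ^^ (i + N)" using assms(1) by (simp add: funpow_add)
    finally show ?case using Suc by simp
  qed simp
  then show ?thesis using assms(2) by (metis le_add_diff_inverse2)
qed

lemma funpow_fixpoint: "f x = x \<Longrightarrow> (f ^^ n) x = x"
  by (induction n) simp_all

lemma semi_idempotentD: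
  assumes "vec_linear S" and "semi_idempotent S"
  obtains N where "S ^^ Suc N = S ^^ N"
proof -
  obtain X Y k where decomp: "\<forall>v. \<exists>x\<in>X. \<exists>y\<in>Y. v = x + y" and "S ` Y \<subseteq> Y"
    and fix_X: "\<forall>x\<in>X. S x = x" and nil_Y: "\<forall>y\<in>Y. (S ^^ k) y = 0"
    using assms(2) unfolding semi_idempotent_def by metis
  have fix_X': "(S ^^ j) x = x" if "x \<in> X" for x j
    using that fix_X by (simp add: funpow_fixpoint)
  have nil_Y': "(S ^^ Suc k) y = 0" if "y \<in> Y" for y
    using that \<open>S ` Y \<subseteq> Y\<close> nil_Y by (auto simp: funpow_Suc_right simp del: funpow.simps)
  have "(S ^^ Suc k) v = (S ^^ k) v" for v
  proof -
    obtain x y where "x \<in> X" "y \<in> Y" "v = x + y" using decomp by blast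
    then show ?thesis
      using fix_X' nil_Y' nil_Y vec.linear_add[OF vec_linear_funpow[OF assms(1)]]
      by (simp del: funpow.simps)
  qed
  then show ?thesis using that by blast
qed

lemma semi_idempotentI:
  assumes "vec_linear S" and stable: "S ^^ Suc N = S ^^ N"
  shows "semi_idempotent S"
  unfolding semi_idempotent_def
proof (intro exI conjI)
  let ?P = "S ^^ N"
  have lin_P: "vec_linear ?P" using vec_linear_funpow[OF assms(1)] .
  have idem: "?P (?P v) = ?P v" for v
    using fun_cong[OF funpow_eq_if_stable[OF stable, of "N + N"]] by (simp add: funpow_add)
  have commute: "S (?P v) = ?P (S v)" for v
    by (rule funpow_swap1)
  show "vec.subspace (range ?P)" "vec.subspace {v. ?P v = 0}"
    using vec.linear_subspace_image[OF lin_P vec.subspace_UNIV] vec.linear_subspace_kernel[OF lin_P]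
    by simp_all
  show "range ?P \<inter> {v. ?P v = 0} = {0}"
    using idem vec.linear_0[OF lin_P] by (auto intro: range_eqI[of _ _ 0])
  show "\<forall>v. \<exists>x\<in>range ?P. \<exists>y\<in>{v. ?P v = 0}. v = x + y"
  proof
    fix v
    show "\<exists>x\<in>range ?P. \<exists>y\<in>{v. ?P v = 0}. v = x + y"
      by (rule bexI[of _ "?P v"], rule bexI[of _ "v - ?P v"]) (simp_all add: idem vec.linear_diff[OF lin_P])
  qed
  show "S ` range ?P \<subseteq> range ?P"
    by (auto simp: commute)
  show "S ` {v. ?P v = 0} \<subseteq> {v. ?P v = 0}"
    using vec.linear_0[OF assms(1)] by (auto simp: commute[symmetric])
  show "\<forall>x\<in>range ?P. S x = x"
    using stable by (auto simp: fun_eq_iff)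
  show "\<forall>y\<in>{v. ?P v = 0}. ?P y = 0" by simp
qed

lemma srk_eqI:
  assumes "\<And>j. N \<le> j \<Longrightarrow> vec.dim (pimage W T j) = d"
  shows "srk W T = d"
  unfolding srk_def
proof (rule the_equality)
  show "\<exists>N. \<forall>j\<ge>N. vec.dim (pimage W T j) = d" using assms by blast
next
  fix d' assume "\<exists>N'. \<forall>j\<ge>N'. vec.dim (pimage W T j) = d'"
  then obtain N' where "\<forall>j\<ge>N'. vec.dim (pimage W T j) = d'" by blast
  then show "d' = d" using assms[of "max N N'"] by simp
qed

lemma pdom_UNIV: "pdom UNIV S j = UNIV"
  by (induction j) auto

lemma srk_UNIV_eq_dim_fixpoints:
  assumes stable: "S ^^ Suc N = S ^^ N"
  shows "srk UNIV S = vec.dim {x. S x = x}"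
proof (rule srk_eqI)
  fix j assume "N \<le> j"
  then have stable_j: "S ^^ Suc j = S ^^ j"
    using funpow_eq_if_stable[OF stable] by (metis le_SucI)
  have "range (S ^^ j) = {x. S x = x}"
  proof (intro set_eqI iffI)
    fix x assume "x \<in> range (S ^^ j)"
    then obtain v where "x = (S ^^ j) v" by blast
    then show "x \<in> {x. S x = x}" using fun_cong[OF stable_j, of v] by simp
  next
    fix x assume "x \<in> {x. S x = x}"
    then have "(S ^^ j) x = x" by (simp add: funpow_fixpoint)
    then show "x \<in> range (S ^^ j)" by (metis rangeI)
  qed
  then show "vec.dim (pimage UNIV S j) = vec.dim {x. S x = x}"
    by (simp add: pimage_def pdom_UNIV)
qed

lemma dim_funpow_preimage_grows:
  fixes S :: "'a::field^'n \<Rightarrow> 'a^'n"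
  assumes "vec_linear S" "vec.subspace U" "S ` U \<subseteq> U" "\<forall>v. (S ^^ N) v \<in> U"
    and "(S ^^ j) -` U \<noteq> UNIV"
  shows "vec.dim U + j \<le> vec.dim ((S ^^ j) -` U)"
proof -
  define Z where "Z j = (S ^^ j) -` U" for j
  have Z_Suc: "Z (Suc j) = S -` Z j" for j
    unfolding Z_def by (simp add: funpow_Suc_right vimage_comp del: funpow.simps)
  have "(S ^^ i) ` U \<subseteq> U" for i
    using assms(3) by (induction i) auto
  then have Z_mono: "Z j \<subseteq> Z (i + j)" for i j
    unfolding Z_def funpow_add by (auto simp: image_subset_iff)
  have subspace_Z: "vec.subspace (Z i)" for i
    unfolding Z_def by (rule vec.linear_subspace_vimage[OF vec_linear_funpow[OF assms(1)] assms(2)])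
  have "Z j \<noteq> UNIV \<Longrightarrow> vec.dim U + j \<le> vec.dim (Z j)" for j
  proof (induction j)
    case (Suc j)
    have "Z (Suc j) \<noteq> Z j"
    proof
      assume "Z (Suc j) = Z j"
      then have "Z (i + j) = Z j" for i by (induction i) (simp_all add: Z_Suc)
      moreover have "Z N \<subseteq> Z (j + N)" by (rule Z_mono)
      moreover have "Z N = UNIV" using assms(4) unfolding Z_def by auto
      ultimately have "Z j = UNIV" by (metis add.commute top.extremum_uniqueI)
      then show False using Suc.prems Z_mono[of j 1] by auto
    qed
    then have "Z j \<subset> Z (Suc j)" using Z_mono[of j 1] by auto
    then have "vec.dim (Z j) < vec.dim (Z (Suc j))"
      by (metis subspace_Z vec.dim_psubset vec.span_eq_iff)
    moreover have "Z j \<noteq> UNIV" using \<open>Z j \<subset> Z (Suc j)\<close> by auto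
    ultimately show ?case using Suc.IH by simp
  qed (simp add: Z_def)
  then show ?thesis using assms(5) unfolding Z_def .
qed

lemma funpow_into_invariant_subspace:
  fixes S :: "'a::field^'n \<Rightarrow> 'a^'n"
  assumes "vec_linear S" "vec.subspace U" "S ` U \<subseteq> U" "\<forall>v. (S ^^ N) v \<in> U"
    and "CARD('n) \<le> vec.dim U + k"
  shows "(S ^^ k) v \<in> U"
proof -
  have "(S ^^ k) -` U = UNIV"
  proof (rule ccontr)
    assume "(S ^^ k) -` U \<noteq> UNIV"
    moreover from this have "vec.dim (UNIV :: ('a^'n) set) \<le> vec.dim ((S ^^ k) -` U)"
      using dim_funpow_preimage_grows[OF assms(1-4)] assms(5) unfolding vec_dim_card
      by (meson order_trans)
    ultimately show False
      using vec.subspace_dim_equal[OF vec.linear_subspace_vimage[OF vec_linear_funpow[OF assms(1)] assms(2)]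
          vec.subspace_UNIV] by blast
  qed
  then show ?thesis by auto
qed

section \<open>Counting vectors over a finite field\<close>

lemma card_span_independent:
  fixes B :: "('a::{field,finite}^'n) set"
  assumes "vec.independent B"
  shows "card (vec.span B) = CARD('a) ^ card B"
proof -
  let ?comb = "\<lambda>u. \<Sum>v\<in>B. u v *s v"
  have fin: "finite B" using assms vec.independent_explicit by blast
  have "?comb u \<in> ?comb ` (B \<rightarrow>\<^sub>E UNIV)" for u
    by (rule rev_image_eqI[of "restrict u B"]) simp_all
  then have "vec.span B = ?comb ` (B \<rightarrow>\<^sub>E UNIV)"
    unfolding vec.span_finite[OF fin] by blast
  moreover have "inj_on ?comb (B \<rightarrow>\<^sub>E UNIV)"
  proof (rule inj_onI)
    fix u u' assume u: "u \<in> B \<rightarrow>\<^sub>E UNIV" "u' \<in> B \<rightarrow>\<^sub>E UNIV" and "?comb u = ?comb u'"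
    then have "(\<Sum>v\<in>B. (u v - u' v) *s v) = 0"
      by (simp add: vec.scale_left_diff_distrib sum_subtractf)
    then have "\<forall>v\<in>B. u v - u' v = 0"
      using assms unfolding vec.independent_explicit by (auto dest!: spec[where x = "\<lambda>v. u v - u' v"])
    then show "u = u'" using u by (auto intro: PiE_ext)
  qed
  ultimately show ?thesis by (simp add: card_image card_funcsetE fin)
qed

lemma card_subspace:
  fixes U :: "('a::{field,finite}^'n) set"
  assumes "vec.subspace U"
  shows "card U = CARD('a) ^ vec.dim U"
proof -
  obtain B where "B \<subseteq> U" "vec.independent B" "U \<subseteq> vec.span B" "card B = vec.dim U"
    using vec.basis_exists by blast
  moreover then have "vec.span B = U" using assms vec.span_minimal by blast
  ultimately show ?thesis using card_span_independent by metis
qed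

lemma card_translate:
  fixes A :: "'b::ab_group_add set"
  shows "card {u. u - v \<in> A} = card A"
proof -
  have "{u. u - v \<in> A} = (\<lambda>y. y + v) ` A" by force
  then show ?thesis by (simp add: card_image)
qed

lemma card_direct_sum_Int:
  fixes F Y R :: "('a::field^'n) set"
  assumes "vec.subspace F" "vec.subspace Y" "F \<inter> Y = {0}"
    and R_invariant: "\<And>f x. f \<in> F \<Longrightarrow> x + f \<in> R \<longleftrightarrow> x \<in> R"
  shows "card ((\<lambda>(f, y). f + y) ` (F \<times> Y) \<inter> R) = card F * card (Y \<inter> R)"
proof -
  have "(\<lambda>(f, y). f + y) ` (F \<times> Y) \<inter> R = (\<lambda>(f, y). f + y) ` (F \<times> (Y \<inter> R))"
    using R_invariant by (force simp: add.commute)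
  moreover have "inj_on (\<lambda>(f, y). f + y) (F \<times> (Y \<inter> R))"
  proof (rule inj_onI, clarify)
    fix f y f' y' assume "f \<in> F" "f' \<in> F" "y \<in> Y" "y' \<in> Y" and "f + y = f' + y'"
    moreover from this have "f - f' = y' - y" by (simp add: algebra_simps)
    ultimately have "f - f' \<in> F \<inter> Y"
      using vec.subspace_diff[OF assms(1), of f f'] vec.subspace_diff[OF assms(2), of y' y] by simp
    then show "f = f' \<and> y = y'" using assms(3) \<open>f + y = f' + y'\<close> by auto
  qed
  ultimately show ?thesis by (simp add: card_image card_cartesian_product)
qed

lemma subspace_add_iff:
  fixes U :: "('a::field^'n) set"
  assumes "vec.subspace U" "f \<in> U"
  shows "x + f \<in> U \<longleftrightarrow> x \<in> U"
proof -
  have span_U: "vec.span U = U" using assms(1) vec.span_eq_iff by blast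
  show ?thesis using vec.span_add_eq2[of f U x] assms(2) by (simp add: span_U)
qed

section \<open>Extensions of a partial map from a hyperplane\<close>

locale hyperplane =
  fixes W :: "('a::field^'n) set"
  assumes subspace_W: "vec.subspace W" and dim_W: "vec.dim W + 1 = CARD('n)"
begin

lemma W_neq_UNIV: "W \<noteq> UNIV"
proof
  assume "W = UNIV"
  then show False using dim_W vec_dim_card[where 'a = 'a and 'n = 'n] by simp
qed

lemma decomp_along:
  assumes "a \<notin> W"
  shows "\<exists>k. v - k *s a \<in> W"
proof -
  have span_W: "vec.span W = W" using subspace_W vec.span_eq_iff by blast
  have "vec.dim (UNIV :: ('a^'n) set) \<le> vec.dim (insert a W)"
    using assms dim_W by (simp add: vec.dim_insert card_cart_basis span_W)
  then have "v \<in> vec.span (insert a W)"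
    using vec.dim_eq_span[of "insert a W" UNIV] by auto
  then show ?thesis by (simp add: vec.span_insert span_W)
qed

definition coord :: "'a^'n \<Rightarrow> 'a^'n \<Rightarrow> 'a" where
  "coord a v = (THE k. v - k *s a \<in> W)"

lemma coord_unique:
  assumes "a \<notin> W" "v - k *s a \<in> W" "v - k' *s a \<in> W"
  shows "k = k'"
proof (rule ccontr)
  assume "k \<noteq> k'"
  have "(v - k *s a) - (v - k' *s a) = (k' - k) *s a" by (simp add: vec.scale_left_diff_distrib)
  then have "(k' - k) *s a \<in> W" using assms(2,3) vec.subspace_diff[OF subspace_W] by metis
  then have "inverse (k' - k) *s ((k' - k) *s a) \<in> W" using vec.subspace_scale[OF subspace_W] by blast
  moreover have "inverse (k' - k) *s ((k' - k) *s a) = a"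
    unfolding vec.scale_scale using \<open>k \<noteq> k'\<close> by simp
  ultimately show False using assms(1) by simp
qed

lemma coord:
  assumes "a \<notin> W" shows "v - coord a v *s a \<in> W"
  unfolding coord_def by (rule theI') (use decomp_along[OF assms] coord_unique[OF assms] in blast)

lemma coord_eqI: "a \<notin> W \<Longrightarrow> v - k *s a \<in> W \<Longrightarrow> coord a v = k"
  using coord coord_unique by blast

lemma coord_eq_0_iff: "a \<notin> W \<Longrightarrow> coord a v = 0 \<longleftrightarrow> v \<in> W"
  using coord[of a v] coord_eqI[of a v 0] by auto

lemma coord_self: "a \<notin> W \<Longrightarrow> coord a a = 1"
  using coord_eqI[of a a 1] vec.subspace_0[OF subspace_W] by simp

lemma coord_add:
  assumes "a \<notin> W" shows "coord a (v + w) = coord a v + coord a w"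
proof (rule coord_eqI[OF assms])
  have "(v - coord a v *s a) + (w - coord a w *s a) \<in> W"
    using vec.subspace_add[OF subspace_W coord[OF assms] coord[OF assms]] .
  then show "v + w - (coord a v + coord a w) *s a \<in> W"
    by (simp add: vec.scale_left_distrib algebra_simps)
qed

lemma coord_scale:
  assumes "a \<notin> W" shows "coord a (c *s v) = c * coord a v"
proof (rule coord_eqI[OF assms])
  show "c *s v - (c * coord a v) *s a \<in> W"
    using vec.subspace_scale[OF subspace_W coord[OF assms], of c]
    by (simp add: vec.scale_right_diff_distrib)
qed

end

declare pdom.simps(2) [simp del]

text \<open>\<open>S0\<close> is one semi-idempotent extension of \<open>T\<close>, serving as a reference point; without one,
  all the counts in the theorem vanish.\<close>

locale hyperplane_extension = hyperplane W for W :: "('a::field^'n) set" +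
  fixes T S0 :: "'a^'n \<Rightarrow> 'a^'n"
  assumes linear_S0: "vec_linear S0" and semi_idempotent_S0: "semi_idempotent S0"
    and S0_extends: "\<And>w. w \<in> W \<Longrightarrow> S0 w = T w"
begin

definition is_extension :: "('a^'n \<Rightarrow> 'a^'n) \<Rightarrow> bool" where
  "is_extension S \<longleftrightarrow> vec_linear S \<and> (\<forall>w\<in>W. S w = T w)"

lemma is_extension_S0: "is_extension S0"
  using linear_S0 S0_extends by (simp add: is_extension_def)

lemma is_extensionD:
  assumes "is_extension S"
  shows "vec_linear S" and "w \<in> W \<Longrightarrow> S w = T w"
  using assms by (simp_all add: is_extension_def)

lemma pdom_eq_and_funpow_eq:
  assumes "is_extension S"
  shows "pdom W T j = {v. \<forall>i<j. (S ^^ i) v \<in> W} \<and> (\<forall>v\<in>pdom W T j. (T ^^ j) v = (S ^^ j) v)"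
proof (induction j)
  case (Suc j)
  then show ?case using is_extensionD(2)[OF assms] by (auto simp: less_Suc_eq pdom.simps(2))
qed simp

lemma pdom_eq: "is_extension S \<Longrightarrow> pdom W T j = {v. \<forall>i<j. (S ^^ i) v \<in> W}"
  using pdom_eq_and_funpow_eq by blast

lemma funpow_eq_on_pdom: "is_extension S \<Longrightarrow> v \<in> pdom W T j \<Longrightarrow> (T ^^ j) v = (S ^^ j) v"
  using pdom_eq_and_funpow_eq by blast

lemma subspace_pdom: "vec.subspace (pdom W T j)"
proof -
  have "pdom W T j = \<Inter> ((\<lambda>i. (S0 ^^ i) -` W) ` {..<j})"
    using pdom_eq[OF is_extension_S0] by auto
  then show ?thesis
    using vec.linear_subspace_vimage[OF vec_linear_funpow[OF linear_S0] subspace_W]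
    by (auto intro: vec.subspace_Inter)
qed

lemma pdom_antimono: "i \<le> j \<Longrightarrow> pdom W T j \<subseteq> pdom W T i"
  using pdom_eq[OF is_extension_S0] by auto

lemma pdom_Suc_iff: "v \<in> pdom W T (Suc j) \<longleftrightarrow> v \<in> W \<and> S0 v \<in> pdom W T j"
  unfolding pdom_eq[OF is_extension_S0]
  by (simp add: All_less_Suc2 funpow_Suc_right del: funpow.simps)

lemma pdom_stabilises: "\<exists>j. pdom W T (Suc j) = pdom W T j"
proof (rule ccontr)
  assume "\<nexists>j. pdom W T (Suc j) = pdom W T j"
  then have "pdom W T (Suc j) \<subset> pdom W T j" for j
    using pdom_antimono[of j "Suc j"] by auto
  then have dim_decreases: "vec.dim (pdom W T (Suc j)) < vec.dim (pdom W T j)" for j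
    using vec.dim_psubset subspace_pdom vec.span_eq_iff by metis
  have "vec.dim (pdom W T j) + j \<le> CARD('n)" for j
  proof (induction j)
    case 0
    then show ?case by (simp add: card_cart_basis)
  next
    case (Suc j)
    then show ?case using dim_decreases[of j] by linarith
  qed
  from this[of "Suc CARD('n)"] show False by simp
qed

definition depth :: nat where
  "depth = (LEAST j. pdom W T (Suc j) = pdom W T j)"

lemma pdom_Suc_depth: "pdom W T (Suc depth) = pdom W T depth"
  unfolding depth_def using pdom_stabilises by (rule LeastI_ex)

lemma pdom_depth_add: "pdom W T (depth + k) = pdom W T depth"
proof (induction k)
  case (Suc k)
  then have "v \<in> pdom W T (depth + Suc k) \<longleftrightarrow> v \<in> pdom W T (Suc depth)" for v
    by (simp add: pdom_Suc_iff)
  then show ?case using pdom_Suc_depth by blast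
qed simp

lemma depth_pos: "0 < depth"
proof (rule ccontr)
  assume "\<not> 0 < depth"
  then have "pdom W T 1 = UNIV" using pdom_Suc_depth by simp
  then show False using W_neq_UNIV by (simp add: pdom_Suc_iff set_eq_iff)
qed

lemma pdom_depth_neq: "pdom W T depth \<noteq> pdom W T (depth - 1)"
  using not_less_Least[of "depth - 1" "\<lambda>j. pdom W T (Suc j) = pdom W T j"] depth_pos
  unfolding depth_def[symmetric] by simp

definition dom_inf :: "('a^'n) set" where
  "dom_inf = pdom W T depth"

lemma dom_inf_eq:
  assumes "is_extension S" shows "dom_inf = {v. \<forall>i. (S ^^ i) v \<in> W}"
proof (intro set_eqI iffI)
  fix v assume "v \<in> dom_inf"
  show "v \<in> {v. \<forall>i. (S ^^ i) v \<in> W}"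
  proof (intro CollectI allI)
    fix i
    have "v \<in> pdom W T (depth + Suc i)"
      using \<open>v \<in> dom_inf\<close> by (simp only: dom_inf_def pdom_depth_add)
    then show "(S ^^ i) v \<in> W" by (auto simp: pdom_eq[OF assms] dest: spec[of _ i])
  qed
next
  fix v assume "v \<in> {v. \<forall>i. (S ^^ i) v \<in> W}"
  then show "v \<in> dom_inf" by (simp add: dom_inf_def pdom_eq[OF assms])
qed

lemma subspace_dom_inf: "vec.subspace dom_inf"
  unfolding dom_inf_def by (rule subspace_pdom)

lemma dom_inf_subset_W: "dom_inf \<subseteq> W"
proof
  fix v assume "v \<in> dom_inf"
  then have "(S0 ^^ 0) v \<in> W" unfolding dom_inf_eq[OF is_extension_S0] by blast
  then show "v \<in> W" by simp
qed

lemma funpow_in_dom_inf: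
  assumes "is_extension S" "v \<in> dom_inf" shows "(S ^^ j) v \<in> dom_inf"
proof -
  have "(S ^^ i) ((S ^^ j) v) = (S ^^ (i + j)) v" for i by (simp add: funpow_add)
  then show ?thesis using assms(2) by (simp add: dom_inf_eq[OF assms(1)])
qed

lemma extension_in_dom_inf: "is_extension S \<Longrightarrow> v \<in> dom_inf \<Longrightarrow> S v \<in> dom_inf"
  using funpow_in_dom_inf[of S v 1] by simp

lemma funpow_eq_on_dom_inf:
  assumes "is_extension S" "v \<in> dom_inf"
  shows "(S ^^ j) v = (S0 ^^ j) v"
proof (induction j)
  case (Suc j)
  have "(S0 ^^ j) v \<in> W" using funpow_in_dom_inf[OF is_extension_S0 assms(2)] dom_inf_subset_W by blast
  then show ?case using Suc is_extensionD(2)[OF assms(1)] S0_extends by simp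
qed simp

definition c :: "'a^'n" where
  "c = (SOME c. c \<in> pdom W T (depth - 1) \<and> c \<notin> pdom W T depth)"

lemma c_in_pdom: "c \<in> pdom W T (depth - 1)" and c_notin_dom_inf: "c \<notin> dom_inf"
proof -
  have "\<exists>c. c \<in> pdom W T (depth - 1) \<and> c \<notin> pdom W T depth"
    using pdom_depth_neq pdom_antimono[of "depth - 1" depth] by auto
  then have "c \<in> pdom W T (depth - 1) \<and> c \<notin> pdom W T depth"
    unfolding c_def by (rule someI_ex)
  then show "c \<in> pdom W T (depth - 1)" "c \<notin> dom_inf" by (simp_all add: dom_inf_def)
qed

text \<open>Every extension \<open>S\<close> is determined by \<open>S v0\<close>, and \<open>S ^^ depth\<close> maps \<open>c\<close> to \<open>S v0\<close>; together with
  the fact that \<open>dom_inf\<close> and the orbit of \<open>c\<close> span the space, this lets \<open>S v0\<close> control all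
  iterates of \<open>S\<close>.\<close>

definition v0 :: "'a^'n" where
  "v0 = (T ^^ (depth - 1)) c"

lemma funpow_c: "is_extension S \<Longrightarrow> j < depth \<Longrightarrow> (S ^^ j) c = (T ^^ j) c"
  using funpow_eq_on_pdom c_in_pdom pdom_antimono[of j "depth - 1"] by force

lemma funpow_c_in_W: "is_extension S \<Longrightarrow> j < depth - 1 \<Longrightarrow> (S ^^ j) c \<in> W"
  using c_in_pdom by (simp add: pdom_eq)

lemma funpow_c_eq_v0: "is_extension S \<Longrightarrow> (S ^^ (depth - 1)) c = v0"
  unfolding v0_def using funpow_c depth_pos by simp

lemma funpow_depth_c: "is_extension S \<Longrightarrow> (S ^^ depth) c = S v0"
  using funpow_c_eq_v0[of S] depth_pos by (metis Suc_diff_1 comp_apply funpow.simps(2))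

lemma v0_notin_W: "v0 \<notin> W"
proof
  assume "v0 \<in> W"
  then have "c \<in> pdom W T (Suc (depth - 1))"
    using c_in_pdom by (simp add: pdom.simps(2) v0_def)
  then show False using c_notin_dom_inf depth_pos by (simp add: dom_inf_def)
qed

lemma pdom_subset_span_insert:
  assumes "i < depth"
  shows "pdom W T i \<subseteq> vec.span (insert ((T ^^ (depth - 1 - i)) c) (pdom W T (Suc i)))"
proof
  fix v assume v: "v \<in> pdom W T i"
  let ?b = "(S0 ^^ (depth - 1 - i)) c"
  have lin: "vec_linear (S0 ^^ k)" for k by (rule vec_linear_funpow[OF linear_S0])
  have b_eq: "(T ^^ (depth - 1 - i)) c = ?b"
    using funpow_c[OF is_extension_S0] assms by simp
  have funpow_b: "(S0 ^^ k) ?b = (S0 ^^ (k + (depth - 1 - i))) c" for k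
    by (simp add: funpow_add)
  define k where "k = coord v0 ((S0 ^^ i) v)"
  have "(S0 ^^ i') (v - k *s ?b) \<in> W" if "i' < Suc i" for i'
  proof -
    have eq: "(S0 ^^ i') (v - k *s ?b) = (S0 ^^ i') v - k *s (S0 ^^ i') ?b"
      using vec.linear_diff[OF lin] vec.linear_scale[OF lin] by simp
    show ?thesis
    proof (cases "i' < i")
      case True
      then have "(S0 ^^ i') v \<in> W" using v by (simp add: pdom_eq[OF is_extension_S0])
      moreover have "(S0 ^^ i') ?b \<in> W"
        unfolding funpow_b using True assms by (intro funpow_c_in_W[OF is_extension_S0]) simp
      ultimately show ?thesis
        unfolding eq using vec.subspace_diff[OF subspace_W] vec.subspace_scale[OF subspace_W] by blast
    next
      case False
      then have "i' = i" using that by simp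
      moreover have "i + (depth - 1 - i) = depth - 1" using assms by simp
      ultimately have "(S0 ^^ i') ?b = v0"
        using funpow_c_eq_v0[OF is_extension_S0] by (simp only: funpow_b)
      then show ?thesis unfolding eq using \<open>i' = i\<close> coord[OF v0_notin_W] by (simp add: k_def)
    qed
  qed
  then have "v - k *s ?b \<in> pdom W T (Suc i)" by (simp add: pdom_eq[OF is_extension_S0])
  then show "v \<in> vec.span (insert ((T ^^ (depth - 1 - i)) c) (pdom W T (Suc i)))"
    unfolding b_eq vec.span_insert using vec.span_base by blast
qed

lemma span_dom_inf_orbit: "vec.span (dom_inf \<union> (\<lambda>j. (T ^^ j) c) ` {..<depth}) = UNIV"
proof -
  let ?B = "\<lambda>j. dom_inf \<union> (\<lambda>j. (T ^^ j) c) ` {..<j}"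
  have "pdom W T (depth - j) \<subseteq> vec.span (?B j)" if "j \<le> depth" for j
    using that
  proof (induction j)
    case 0
    then show ?case by (simp add: dom_inf_def vec.span_superset)
  next
    case (Suc j)
    have "vec.span (?B j) \<subseteq> vec.span (?B (Suc j))" by (rule vec.span_mono) auto
    then have "insert ((T ^^ j) c) (pdom W T (depth - j)) \<subseteq> vec.span (?B (Suc j))"
      using Suc by (auto intro: vec.span_base)
    then have "vec.span (insert ((T ^^ j) c) (pdom W T (depth - j))) \<subseteq> vec.span (?B (Suc j))"
      by (rule vec.span_minimal[OF _ vec.subspace_span])
    moreover have "pdom W T (depth - Suc j) \<subseteq> vec.span (insert ((T ^^ j) c) (pdom W T (depth - j)))"
      using pdom_subset_span_insert[of "depth - Suc j"] Suc.prems
      by (simp add: Suc_diff_Suc diff_diff_cancel)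
    ultimately show ?case by blast
  qed
  from this[of depth] show ?thesis by auto
qed

lemma eq_UNIV_if_contains_orbit:
  assumes "vec.subspace Z" "dom_inf \<subseteq> Z" "\<And>j. j < depth \<Longrightarrow> (T ^^ j) c \<in> Z"
  shows "Z = UNIV"
  using vec.span_minimal[OF _ assms(1), of "dom_inf \<union> (\<lambda>j. (T ^^ j) c) ` {..<depth}"] assms(2,3)
  by (auto simp: span_dom_inf_orbit)

lemma dim_dom_inf: "CARD('n) \<le> vec.dim dom_inf + depth"
proof -
  obtain B where B: "B \<subseteq> dom_inf" "vec.independent B" "dom_inf \<subseteq> vec.span B" "card B = vec.dim dom_inf"
    using vec.basis_exists by blast
  let ?orbit = "(\<lambda>j. (T ^^ j) c) ` {..<depth}"
  have "dom_inf \<union> ?orbit \<subseteq> vec.span (B \<union> ?orbit)"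
    using B(3) vec.span_mono[of B "B \<union> ?orbit"] vec.span_superset[of "B \<union> ?orbit"] by blast
  then have "UNIV \<subseteq> vec.span (B \<union> ?orbit)"
    using vec.span_minimal[OF _ vec.subspace_span] span_dom_inf_orbit by metis
  moreover have "finite (B \<union> ?orbit)" using B(2) vec.independent_bound_general by blast
  ultimately have "vec.dim (UNIV :: ('a^'n) set) \<le> card (B \<union> ?orbit)"
    by (rule vec.dim_le_card)
  also have "\<dots> \<le> card B + card ?orbit" by (rule card_Un_le)
  also have "\<dots> \<le> vec.dim dom_inf + depth" using B(4) card_image_le[of "{..<depth}"] by simp
  finally show ?thesis by (simp only: vec_dim_card)
qed

definition ext_by :: "'a^'n \<Rightarrow> 'a^'n \<Rightarrow> 'a^'n" where
  "ext_by u v = S0 v + coord v0 v *s (u - S0 v0)"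

lemma is_extension_ext_by: "is_extension (ext_by u)"
  unfolding is_extension_def
proof
  show "vec_linear (ext_by u)"
  proof (rule vec_linearI)
    fix x y
    show "ext_by u (x + y) = ext_by u x + ext_by u y"
      by (simp add: ext_by_def vec.linear_add[OF linear_S0] coord_add[OF v0_notin_W]
          vec.scale_left_distrib)
  next
    fix a x
    show "ext_by u (a *s x) = a *s ext_by u x"
      by (simp add: ext_by_def vec.linear_scale[OF linear_S0] coord_scale[OF v0_notin_W]
          vec.scale_right_distrib)
  qed
  show "\<forall>w\<in>W. ext_by u w = T w"
    using S0_extends coord_eq_0_iff[OF v0_notin_W] by (simp add: ext_by_def)
qed

lemma ext_by_v0: "ext_by u v0 = u"
  by (simp add: ext_by_def coord_self[OF v0_notin_W])

lemma ext_by_eq: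
  assumes "is_extension S" shows "ext_by (S v0) = S"
proof
  fix v
  let ?w = "v - coord v0 v *s v0"
  have "?w \<in> W" by (rule coord[OF v0_notin_W])
  then have "S ?w = S0 ?w" using is_extensionD(2)[OF assms] S0_extends by simp
  then show "ext_by (S v0) v = S v"
    using vec.linear_diff[OF linear_S0] vec.linear_diff[OF is_extensionD(1)[OF assms]]
      vec.linear_scale[OF linear_S0] vec.linear_scale[OF is_extensionD(1)[OF assms]]
    by (simp add: ext_by_def vec.scale_right_diff_distrib algebra_simps)
qed

lemma card_extensions:
  "card {S. vec_linear S \<and> semi_idempotent S \<and> (\<forall>w\<in>W. S w = T w) \<and> P S}
   = card {u. semi_idempotent (ext_by u) \<and> P (ext_by u)}"
proof -
  have "{S. vec_linear S \<and> semi_idempotent S \<and> (\<forall>w\<in>W. S w = T w) \<and> P S}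
      = ext_by ` {u. semi_idempotent (ext_by u) \<and> P (ext_by u)}"
  proof (intro set_eqI iffI)
    fix S assume "S \<in> {S. vec_linear S \<and> semi_idempotent S \<and> (\<forall>w\<in>W. S w = T w) \<and> P S}"
    then have "is_extension S" "semi_idempotent S" "P S" by (simp_all add: is_extension_def)
    then show "S \<in> ext_by ` {u. semi_idempotent (ext_by u) \<and> P (ext_by u)}"
      using ext_by_eq by (intro image_eqI[of S ext_by "S v0"]) simp_all
  next
    fix S assume "S \<in> ext_by ` {u. semi_idempotent (ext_by u) \<and> P (ext_by u)}"
    then show "S \<in> {S. vec_linear S \<and> semi_idempotent S \<and> (\<forall>w\<in>W. S w = T w) \<and> P S}"
      using is_extension_ext_by by (auto simp: is_extension_def)
  qed
  moreover have "inj ext_by" by (metis ext_by_v0 injI)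
  ultimately show ?thesis by (simp add: card_image inj_on_subset)
qed

text \<open>The restriction of \<open>T\<close> to \<open>dom_inf\<close> is semi-idempotent; \<open>fix_part\<close> and \<open>nil_part\<close> are
  its fixed and nilpotent parts.\<close>

definition fix_part :: "('a^'n) set" where
  "fix_part = {w \<in> W. T w = w}"

definition nil_part :: "('a^'n) set" where
  "nil_part = (\<lambda>z. T z - z) ` dom_inf"

lemma fixpoints_Int_W: "is_extension S \<Longrightarrow> {x. S x = x} \<inter> W = fix_part"
  unfolding fix_part_def using is_extensionD(2) by auto

lemma funpow_fix_part: "is_extension S \<Longrightarrow> f \<in> fix_part \<Longrightarrow> (S ^^ i) f = f"
  by (rule funpow_fixpoint) (simp add: fix_part_def is_extensionD(2))

lemma subspace_fix_part: "vec.subspace fix_part"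
proof -
  have "fix_part = {x. S0 x = x} \<inter> W" using fixpoints_Int_W[OF is_extension_S0] by simp
  then show ?thesis by (simp add: vec.subspace_inter subspace_fixpoints[OF linear_S0] subspace_W)
qed

lemma fix_part_subset_dom_inf: "fix_part \<subseteq> dom_inf"
proof
  fix f assume "f \<in> fix_part"
  then show "f \<in> dom_inf"
    using funpow_fix_part[OF is_extension_S0] by (simp add: dom_inf_eq[OF is_extension_S0] fix_part_def)
qed

lemma fix_part_subset_image: "fix_part \<subseteq> T ` W"
  unfolding fix_part_def by force

lemma nil_part_eq: "is_extension S \<Longrightarrow> nil_part = (\<lambda>z. S z - z) ` dom_inf"
  unfolding nil_part_def using dom_inf_subset_W is_extensionD(2) by (intro image_cong) auto

lemma subspace_nil_part: "vec.subspace nil_part"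
  unfolding nil_part_eq[OF is_extension_S0]
  using vec.linear_subspace_image[OF vec.linear_compose_sub[OF linear_S0 vec.linear_id] subspace_dom_inf]
  by simp

lemma nil_part_subset_dom_inf: "nil_part \<subseteq> dom_inf"
  unfolding nil_part_eq[OF is_extension_S0]
  using extension_in_dom_inf[OF is_extension_S0] vec.subspace_diff[OF subspace_dom_inf] by blast

definition K :: nat where
  "K = (SOME K. S0 ^^ Suc K = S0 ^^ K)"

lemma S0_funpow_Suc_K: "S0 ^^ Suc K = S0 ^^ K"
  unfolding K_def by (rule someI_ex) (use semi_idempotentD[OF linear_S0 semi_idempotent_S0] in blast)

lemma funpow_Suc_K_on_dom_inf:
  "is_extension S \<Longrightarrow> z \<in> dom_inf \<Longrightarrow> (S ^^ Suc K) z = (S ^^ K) z"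
  using funpow_eq_on_dom_inf S0_funpow_Suc_K by metis

lemma funpow_K_nil_part:
  assumes "is_extension S" "y \<in> nil_part"
  shows "(S ^^ K) y = 0"
proof -
  obtain z where z: "z \<in> dom_inf" "y = S z - z" using assms nil_part_eq by blast
  have "(S ^^ K) y = (S ^^ Suc K) z - (S ^^ K) z"
    using vec.linear_diff[OF vec_linear_funpow[OF is_extensionD(1)[OF assms(1)]]] z(2)
    by (simp add: funpow_swap1)
  then show ?thesis using funpow_Suc_K_on_dom_inf[OF assms(1) z(1)] by simp
qed

lemma fix_part_Int_nil_part: "fix_part \<inter> nil_part = {0}"
  using funpow_fix_part[OF is_extension_S0] funpow_K_nil_part[OF is_extension_S0]
    vec.subspace_0[OF subspace_fix_part] vec.subspace_0[OF subspace_nil_part] by fastforce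

lemma dom_inf_eq_sum: "dom_inf = (\<lambda>(f, y). f + y) ` (fix_part \<times> nil_part)"
proof (intro set_eqI iffI)
  fix z assume z: "z \<in> dom_inf"
  have "(S0 ^^ K) z \<in> dom_inf" by (rule funpow_in_dom_inf[OF is_extension_S0 z])
  moreover have "S0 ((S0 ^^ K) z) = (S0 ^^ K) z" using S0_funpow_Suc_K by (metis comp_apply funpow.simps(2))
  ultimately have "(S0 ^^ K) z \<in> fix_part"
    using fixpoints_Int_W[OF is_extension_S0] dom_inf_subset_W by blast
  moreover have "z - (S0 ^^ j) z \<in> nil_part" for j
  proof (induction j)
    case (Suc j)
    let ?w = "(S0 ^^ j) z"
    have "S0 ?w - ?w \<in> nil_part"
      using funpow_in_dom_inf[OF is_extension_S0 z] by (simp add: nil_part_eq[OF is_extension_S0])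
    then have "(z - ?w) - (S0 ?w - ?w) \<in> nil_part"
      using Suc vec.subspace_diff[OF subspace_nil_part] by blast
    then show ?case by simp
  qed (simp add: vec.subspace_0[OF subspace_nil_part])
  ultimately show "z \<in> (\<lambda>(f, y). f + y) ` (fix_part \<times> nil_part)"
    by (intro image_eqI[of z _ "((S0 ^^ K) z, z - (S0 ^^ K) z)"]) auto
next
  fix z assume "z \<in> (\<lambda>(f, y). f + y) ` (fix_part \<times> nil_part)"
  then show "z \<in> dom_inf"
    using fix_part_subset_dom_inf nil_part_subset_dom_inf vec.subspace_add[OF subspace_dom_inf] by auto
qed

lemma srk_T: "srk W T = vec.dim fix_part"
proof (rule srk_eqI)
  fix j assume j: "depth + K \<le> j"
  have pdom_j: "pdom W T j = dom_inf"
    using pdom_depth_add[of "j - depth"] j by (simp add: dom_inf_def)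
  have stable_j: "S0 ^^ Suc j = S0 ^^ j"
    using funpow_eq_if_stable[OF S0_funpow_Suc_K] j by (metis add_leD2 le_SucI)
  have "pimage W T j = (S0 ^^ j) ` dom_inf"
    unfolding pimage_def pdom_j using funpow_eq_on_pdom[OF is_extension_S0] pdom_j
    by (intro image_cong) auto
  also have "\<dots> = fix_part"
  proof (intro set_eqI iffI)
    fix x assume "x \<in> (S0 ^^ j) ` dom_inf"
    then obtain z where z: "z \<in> dom_inf" "x = (S0 ^^ j) z" by blast
    then have "S0 x = x" using fun_cong[OF stable_j, of z] by simp
    moreover have "x \<in> W" using z funpow_in_dom_inf[OF is_extension_S0] dom_inf_subset_W by blast
    ultimately show "x \<in> fix_part" using fixpoints_Int_W[OF is_extension_S0] by blast
  next
    fix f assume f: "f \<in> fix_part"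
    then have "(S0 ^^ j) f = f" by (rule funpow_fix_part[OF is_extension_S0])
    then show "f \<in> (S0 ^^ j) ` dom_inf" using f fix_part_subset_dom_inf by (metis image_eqI subsetD)
  qed
  finally show "vec.dim (pimage W T j) = vec.dim fix_part" by simp
qed

lemma fixpoints_eq_span_insert:
  assumes "is_extension S" "S x = x" "x \<notin> W"
  shows "{y. S y = y} = vec.span (insert x fix_part)"
proof
  have lin: "vec_linear S" by (rule is_extensionD(1)[OF assms(1)])
  show "{y. S y = y} \<subseteq> vec.span (insert x fix_part)"
  proof
    fix y assume y: "y \<in> {y. S y = y}"
    let ?w = "y - coord x y *s x"
    have "?w \<in> W" by (rule coord[OF assms(3)])
    moreover have "S ?w = ?w"
      using y assms(2) vec.linear_diff[OF lin] vec.linear_scale[OF lin] by simp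
    ultimately have "?w \<in> fix_part" using fixpoints_Int_W[OF assms(1)] by blast
    then show "y \<in> vec.span (insert x fix_part)"
      unfolding vec.span_insert using vec.span_base by blast
  qed
  show "vec.span (insert x fix_part) \<subseteq> {y. S y = y}"
    using fixpoints_Int_W[OF assms(1)] assms(2)
    by (intro vec.span_minimal[OF _ subspace_fixpoints[OF lin]]) auto
qed

lemma srk_extension:
  assumes "is_extension S" "semi_idempotent S"
  shows "srk UNIV S = (if {x. S x = x} \<subseteq> W then vec.dim fix_part else vec.dim fix_part + 1)"
proof -
  obtain N where "S ^^ Suc N = S ^^ N"
    using semi_idempotentD[OF is_extensionD(1)[OF assms(1)] assms(2)] .
  then have srk: "srk UNIV S = vec.dim {x. S x = x}" by (rule srk_UNIV_eq_dim_fixpoints)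
  show ?thesis
  proof (cases "{x. S x = x} \<subseteq> W")
    case True
    then have "{x. S x = x} = fix_part" using fixpoints_Int_W[OF assms(1)] by blast
    then show ?thesis using True srk by simp
  next
    case False
    then obtain x where x: "S x = x" "x \<notin> W" by blast
    moreover have "vec.span fix_part = fix_part" using subspace_fix_part vec.span_eq_iff by blast
    ultimately have "x \<notin> vec.span fix_part" unfolding fix_part_def by blast
    then show ?thesis
      using False srk fixpoints_eq_span_insert[OF assms(1) x] by (simp add: vec.dim_insert)
  qed
qed

lemma subspace_image_T: "vec.subspace (T ` W)"
proof -
  have "T ` W = S0 ` W" using S0_extends by simp
  then show ?thesis using vec.linear_subspace_image[OF linear_S0 subspace_W] by simp
qed

lemma range_ext_by: "range (ext_by u) = vec.span (insert u (T ` W))"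
proof -
  have span_TW: "vec.span (T ` W) = T ` W" using subspace_image_T vec.span_eq_iff by blast
  have lin: "vec_linear (ext_by u)" by (rule is_extensionD(1)[OF is_extension_ext_by])
  have ext_by_alt: "ext_by u v = T (v - coord v0 v *s v0) + coord v0 v *s u" for v
  proof -
    have "T (v - coord v0 v *s v0) = S0 v - coord v0 v *s S0 v0"
      using S0_extends[OF coord[OF v0_notin_W]] vec.linear_diff[OF linear_S0]
        vec.linear_scale[OF linear_S0] by simp
    then show ?thesis by (simp add: ext_by_def vec.scale_right_diff_distrib diff_add_eq add_diff_eq)
  qed
  show ?thesis
  proof (intro set_eqI iffI)
    fix y assume "y \<in> range (ext_by u)"
    then obtain v where "y = ext_by u v" by blast
    then have "y - coord v0 v *s u \<in> T ` W" using ext_by_alt coord[OF v0_notin_W] by simp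
    then show "y \<in> vec.span (insert u (T ` W))" by (auto simp: vec.span_insert span_TW)
  next
    fix y assume "y \<in> vec.span (insert u (T ` W))"
    then obtain k w where "w \<in> W" "y - k *s u = T w" by (auto simp: vec.span_insert span_TW)
    moreover have "ext_by u (w + k *s v0) = T w + k *s u"
      using vec.linear_add[OF lin] vec.linear_scale[OF lin] ext_by_v0
        is_extensionD(2)[OF is_extension_ext_by \<open>w \<in> W\<close>] by simp
    ultimately show "y \<in> range (ext_by u)" by (metis diff_add_cancel rangeI)
  qed
qed

lemma prank_ext_by:
  "prank UNIV (ext_by u) = (if u \<in> T ` W then prank W T else prank W T + 1)"
proof -
  have span_TW: "vec.span (T ` W) = T ` W" using subspace_image_T vec.span_eq_iff by blast
  show ?thesis by (simp add: prank_def range_ext_by vec.dim_insert span_TW)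
qed

lemma v0_in_image:
  assumes "\<not> T ` W \<subseteq> W"
  shows "v0 \<in> T ` W"
proof -
  have "depth \<noteq> 1"
  proof
    assume "depth = 1"
    then have "dom_inf = W" by (simp add: dom_inf_def pdom.simps(2))
    then show False
      using assms extension_in_dom_inf[OF is_extension_S0] S0_extends by auto
  qed
  then obtain k where k: "depth = Suc (Suc k)" using depth_pos by (metis One_nat_def Suc_pred not0_implies_Suc)
  then have "(S0 ^^ k) c \<in> W" using funpow_c_in_W[OF is_extension_S0] by simp
  moreover have "v0 = S0 ((S0 ^^ k) c)" using funpow_c_eq_v0[OF is_extension_S0] k by simp
  ultimately show ?thesis using S0_extends by simp
qed

lemma extension_in_nil_part:
  assumes "is_extension S" "y \<in> nil_part"
  shows "S y \<in> nil_part"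
proof -
  obtain z where z: "z \<in> dom_inf" "y = S z - z" using assms nil_part_eq by blast
  have "S y = S (S z) - S z" using z(2) vec.linear_diff[OF is_extensionD(1)[OF assms(1)]] by simp
  then show ?thesis
    using extension_in_dom_inf[OF assms(1) z(1)] by (simp add: nil_part_eq[OF assms(1)])
qed

lemma commuting_map_into_invariant_subspace:
  assumes "is_extension S" "vec_linear g" "\<And>v. g (S v) = S (g v)"
    and "vec.subspace A" "S ` A \<subseteq> A" "g ` dom_inf \<subseteq> A" "g c \<in> A"
  shows "g v \<in> A"
proof -
  have "g -` A = UNIV"
  proof (rule eq_UNIV_if_contains_orbit)
    show "vec.subspace (g -` A)" by (rule vec.linear_subspace_vimage[OF assms(2,4)])
    show "dom_inf \<subseteq> g -` A" using assms(6) by blast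
    fix j assume "j < depth"
    have "g ((S ^^ j) c) = (S ^^ j) (g c)" by (induction j) (simp_all add: assms(3))
    moreover have "(S ^^ j) (g c) \<in> A" using assms(5,7) by (induction j) auto
    ultimately show "(T ^^ j) c \<in> g -` A" using funpow_c[OF assms(1) \<open>j < depth\<close>] by simp
  qed
  then show ?thesis by blast
qed

lemma in_dom_inf_if_fixpoints_in_W:
  assumes "semi_idempotent (ext_by u)" "{x. ext_by u x = x} \<subseteq> W"
  shows "u \<in> dom_inf"
proof -
  let ?S = "ext_by u"
  have ext: "is_extension ?S" by (rule is_extension_ext_by)
  obtain N where N: "?S ^^ Suc N = ?S ^^ N"
    using semi_idempotentD[OF is_extensionD(1)[OF ext] assms(1)] .
  have "(?S ^^ N) v \<in> dom_inf" for v
  proof -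
    have "?S ((?S ^^ N) v) = (?S ^^ N) v" using fun_cong[OF N, of v] by simp
    then have "(?S ^^ N) v \<in> fix_part" using assms(2) fixpoints_Int_W[OF ext] by blast
    then show ?thesis using fix_part_subset_dom_inf by blast
  qed
  then have "(?S ^^ depth) c \<in> dom_inf"
    using funpow_into_invariant_subspace[OF is_extensionD(1)[OF ext] subspace_dom_inf _ _ dim_dom_inf]
      extension_in_dom_inf[OF ext] by blast
  then show ?thesis using funpow_depth_c[OF ext] ext_by_v0 by simp
qed

lemma semi_idempotent_ext_by_if_in_dom_inf:
  assumes "u \<in> dom_inf"
  shows "semi_idempotent (ext_by u)" and "{x. ext_by u x = x} \<subseteq> W"
proof -
  let ?S = "ext_by u"
  have ext: "is_extension ?S" by (rule is_extension_ext_by)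
  have lin: "vec_linear ?S" by (rule is_extensionD(1)[OF ext])
  have into: "(?S ^^ depth) v \<in> dom_inf" for v
  proof (rule commuting_map_into_invariant_subspace[OF ext vec_linear_funpow[OF lin]])
    show "(?S ^^ depth) (?S v) = ?S ((?S ^^ depth) v)" for v by (rule funpow_swap1[symmetric])
    show "?S ` dom_inf \<subseteq> dom_inf" "(?S ^^ depth) ` dom_inf \<subseteq> dom_inf"
      using extension_in_dom_inf[OF ext] funpow_in_dom_inf[OF ext] by blast+
    show "(?S ^^ depth) c \<in> dom_inf" using funpow_depth_c[OF ext] ext_by_v0 assms by simp
  qed (rule subspace_dom_inf)
  have "?S ^^ Suc (K + depth) = ?S ^^ (K + depth)"
  proof
    fix v
    have "(?S ^^ Suc (K + depth)) v = (?S ^^ Suc K) ((?S ^^ depth) v)" by (simp add: funpow_add)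
    also have "\<dots> = (?S ^^ K) ((?S ^^ depth) v)" using funpow_Suc_K_on_dom_inf[OF ext into] .
    finally show "(?S ^^ Suc (K + depth)) v = (?S ^^ (K + depth)) v" by (simp add: funpow_add)
  qed
  then show "semi_idempotent ?S" by (rule semi_idempotentI[OF lin])
  show "{x. ?S x = x} \<subseteq> W"
  proof
    fix x assume "x \<in> {x. ?S x = x}"
    then have "(?S ^^ depth) x = x" by (simp add: funpow_fixpoint)
    then show "x \<in> W" using into[of x] dom_inf_subset_W by auto
  qed
qed

lemma fixpoints_in_W_iff: 
  "semi_idempotent (ext_by u) \<and> {x. ext_by u x = x} \<subseteq> W \<longleftrightarrow> u \<in> dom_inf"
  using in_dom_inf_if_fixpoints_in_W semi_idempotent_ext_by_if_in_dom_inf by blast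

lemma diff_v0_in_nil_part_if_fixpoint_outside_W:
  assumes "semi_idempotent (ext_by u)" "\<not> {x. ext_by u x = x} \<subseteq> W"
  shows "u - v0 \<in> nil_part"
proof -
  let ?S = "ext_by u"
  have ext: "is_extension ?S" by (rule is_extension_ext_by)
  have lin: "vec_linear ?S" by (rule is_extensionD(1)[OF ext])
  obtain N where N: "?S ^^ Suc N = ?S ^^ N" using semi_idempotentD[OF lin assms(1)] .
  obtain x where x: "?S x = x" "x \<notin> W" using assms(2) by blast
  let ?U = "vec.span (insert x dom_inf)"
  have span_dom_inf: "vec.span dom_inf = dom_inf" using subspace_dom_inf vec.span_eq_iff by blast
  have U_iff: "v \<in> ?U \<longleftrightarrow> (\<exists>k. v - k *s x \<in> dom_inf)" for v
    by (simp add: vec.span_insert span_dom_inf)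
  have "?S ` ?U \<subseteq> ?U"
  proof (clarsimp simp: U_iff)
    fix v k assume "v - k *s x \<in> dom_inf"
    then have "?S (v - k *s x) \<in> dom_inf" by (rule extension_in_dom_inf[OF ext])
    then show "\<exists>k. ?S v - k *s x \<in> dom_inf"
      using x(1) vec.linear_diff[OF lin] vec.linear_scale[OF lin] by auto
  qed
  moreover have "(?S ^^ N) v \<in> ?U" for v
  proof -
    have "?S ((?S ^^ N) v) = (?S ^^ N) v" using fun_cong[OF N, of v] by simp
    then have "(?S ^^ N) v \<in> vec.span (insert x fix_part)"
      using fixpoints_eq_span_insert[OF ext x] by blast
    then show ?thesis using vec.span_mono[of "insert x fix_part" "insert x dom_inf"]
      fix_part_subset_dom_inf by blast
  qed
  moreover have "vec.dim ?U = vec.dim dom_inf + 1"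
    using x(2) dom_inf_subset_W by (auto simp: vec.dim_insert span_dom_inf)
  ultimately have "(?S ^^ (depth - 1)) c \<in> ?U"
    using dim_dom_inf depth_pos by (intro funpow_into_invariant_subspace[OF lin vec.subspace_span]) auto
  then obtain k where z: "v0 - k *s x \<in> dom_inf"
    using funpow_c_eq_v0[OF ext] U_iff by auto
  have "u - v0 = ?S (v0 - k *s x) - (v0 - k *s x)"
    using ext_by_v0 x(1) vec.linear_diff[OF lin] vec.linear_scale[OF lin] by simp
  then show ?thesis using z unfolding nil_part_eq[OF ext] by blast
qed

lemma semi_idempotent_ext_by_if_diff_v0_in_nil_part:
  assumes "u - v0 \<in> nil_part"
  shows "semi_idempotent (ext_by u)" and "\<not> {x. ext_by u x = x} \<subseteq> W"
proof -
  let ?S = "ext_by u"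
  have ext: "is_extension ?S" by (rule is_extension_ext_by)
  have lin: "vec_linear ?S" by (rule is_extensionD(1)[OF ext])
  obtain z where z: "z \<in> dom_inf" "u - v0 = ?S z - z" using assms nil_part_eq[OF ext] by blast
  have "?S (v0 - z) = u - ?S z" using ext_by_v0 vec.linear_diff[OF lin] by simp
  also have "\<dots> = v0 - z" using z(2) by (simp add: algebra_simps)
  finally have "?S (v0 - z) = v0 - z" .
  moreover have "v0 - z \<notin> W"
    using v0_notin_W z(1) dom_inf_subset_W vec.subspace_add[OF subspace_W, of "v0 - z" z] by auto
  ultimately show "\<not> {x. ?S x = x} \<subseteq> W" by blast
  let ?g = "\<lambda>v. (?S ^^ Suc (depth - 1)) v - (?S ^^ (depth - 1)) v"
  have into: "?g v \<in> nil_part" for v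
  proof (rule commuting_map_into_invariant_subspace[OF ext, where g = ?g])
    show "vec_linear ?g" by (rule vec.linear_compose_sub[OF vec_linear_funpow[OF lin] vec_linear_funpow[OF lin]])
    show "?g (?S v) = ?S (?g v)" for v
      using vec.linear_diff[OF lin] by (simp add: funpow_swap1)
    show "?S ` nil_part \<subseteq> nil_part" using extension_in_nil_part[OF ext] by blast
    show "?g ` dom_inf \<subseteq> nil_part"
      using funpow_in_dom_inf[OF ext] by (auto simp: nil_part_eq[OF ext])
    show "?g c \<in> nil_part" using funpow_c_eq_v0[OF ext] ext_by_v0 assms by simp
  qed (rule subspace_nil_part)
  have "?S ^^ Suc (K + (depth - 1)) = ?S ^^ (K + (depth - 1))"
  proof
    fix v
    have "(?S ^^ K) (?g v) = 0" by (rule funpow_K_nil_part[OF ext into])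
    then have "(?S ^^ K) ((?S ^^ Suc (depth - 1)) v) = (?S ^^ K) ((?S ^^ (depth - 1)) v)"
      using vec.linear_diff[OF vec_linear_funpow[OF lin]] by simp
    then show "(?S ^^ Suc (K + (depth - 1))) v = (?S ^^ (K + (depth - 1))) v"
      by (simp only: add_Suc_right[symmetric] funpow_add comp_apply)
  qed
  then show "semi_idempotent ?S" by (rule semi_idempotentI[OF lin])
qed

lemma fixpoint_outside_W_iff:
  "semi_idempotent (ext_by u) \<and> \<not> {x. ext_by u x = x} \<subseteq> W \<longleftrightarrow> u - v0 \<in> nil_part"
  using diff_v0_in_nil_part_if_fixpoint_outside_W semi_idempotent_ext_by_if_diff_v0_in_nil_part
  by blast

end

section \<open>Counting semi-idempotent extensions\<close>

locale finite_hyperplane_extension = hyperplane_extension W T S0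
  for W :: "('a::{field,finite}^'n) set" and T S0
begin

lemma card_srk_extensions_eq:
  assumes P_iff: "\<And>u. P (ext_by u) \<longleftrightarrow> u \<in> R"
    and R_invariant: "\<And>f x. f \<in> fix_part \<Longrightarrow> x + f \<in> R \<longleftrightarrow> x \<in> R"
    and R_v0: "\<And>x. x - v0 \<in> R \<longleftrightarrow> x \<in> R"
  shows "card {S. vec_linear S \<and> semi_idempotent S \<and> (\<forall>w\<in>W. S w = T w) \<and> P S \<and> srk UNIV S = srk W T}
    = CARD('a) ^ srk W T *
      card {S. vec_linear S \<and> semi_idempotent S \<and> (\<forall>w\<in>W. S w = T w) \<and> P S \<and> srk UNIV S = srk W T + 1}"
proof -
  have srk_iff: "srk UNIV (ext_by u) = srk W T \<longleftrightarrow> {x. ext_by u x = x} \<subseteq> W"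
    "srk UNIV (ext_by u) = srk W T + 1 \<longleftrightarrow> \<not> {x. ext_by u x = x} \<subseteq> W"
    if "semi_idempotent (ext_by u)" for u
    using srk_extension[OF is_extension_ext_by that] by (simp_all add: srk_T)
  have "{u. semi_idempotent (ext_by u) \<and> P (ext_by u) \<and> srk UNIV (ext_by u) = srk W T}
      = dom_inf \<inter> R"
  proof (intro set_eqI)
    fix u
    show "u \<in> {u. semi_idempotent (ext_by u) \<and> P (ext_by u) \<and> srk UNIV (ext_by u) = srk W T}
        \<longleftrightarrow> u \<in> dom_inf \<inter> R"
      using fixpoints_in_W_iff[of u] srk_iff(1)[of u] P_iff[of u] by auto
  qed
  then have "card {S. vec_linear S \<and> semi_idempotent S \<and> (\<forall>w\<in>W. S w = T w) \<and> P S \<and> srk UNIV S = srk W T}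
      = card (dom_inf \<inter> R)"
    by (simp add: card_extensions)
  also have "\<dots> = card fix_part * card (nil_part \<inter> R)"
    unfolding dom_inf_eq_sum
    by (rule card_direct_sum_Int[OF subspace_fix_part subspace_nil_part fix_part_Int_nil_part R_invariant])
  also have "card (nil_part \<inter> R) = card {u. u - v0 \<in> nil_part \<inter> R}"
    by (rule card_translate[symmetric])
  also have "{u. u - v0 \<in> nil_part \<inter> R}
      = {u. semi_idempotent (ext_by u) \<and> P (ext_by u) \<and> srk UNIV (ext_by u) = srk W T + 1}"
  proof (intro set_eqI)
    fix u
    show "u \<in> {u. u - v0 \<in> nil_part \<inter> R} \<longleftrightarrow>
        u \<in> {u. semi_idempotent (ext_by u) \<and> P (ext_by u) \<and> srk UNIV (ext_by u) = srk W T + 1}"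
      using fixpoint_outside_W_iff[of u] srk_iff(2)[of u] P_iff[of u] R_v0[of u] by auto
  qed
  finally show ?thesis
    unfolding card_extensions card_subspace[OF subspace_fix_part] srk_T by simp
qed

lemma e2_srk: "e2 W T (srk W T) = CARD('a) ^ srk W T * e2 W T (srk W T + 1)"
  using card_srk_extensions_eq[of "\<lambda>_. True" UNIV] by (simp add: e2_def)

lemma e3_srk:
  assumes "\<not> T ` W \<subseteq> W"
  shows "e3 W T (prank W T) (srk W T) = CARD('a) ^ srk W T * e3 W T (prank W T) (srk W T + 1)"
    and "e3 W T (prank W T + 1) (srk W T) = CARD('a) ^ srk W T * e3 W T (prank W T + 1) (srk W T + 1)"
proof -
  have fix_part_inv: "x + f \<in> T ` W \<longleftrightarrow> x \<in> T ` W" if "f \<in> fix_part" for f x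
    using subspace_add_iff[OF subspace_image_T] fix_part_subset_image that by blast
  have v0_inv: "x - v0 \<in> T ` W \<longleftrightarrow> x \<in> T ` W" for x
    using subspace_add_iff[OF subspace_image_T v0_in_image[OF assms], of "x - v0"] by simp
  show "e3 W T (prank W T) (srk W T) = CARD('a) ^ srk W T * e3 W T (prank W T) (srk W T + 1)"
    using card_srk_extensions_eq[of "\<lambda>S. prank UNIV S = prank W T" "T ` W"]
      fix_part_inv v0_inv by (simp add: e3_def prank_ext_by)
  show "e3 W T (prank W T + 1) (srk W T) = CARD('a) ^ srk W T * e3 W T (prank W T + 1) (srk W T + 1)"
    using card_srk_extensions_eq[of "\<lambda>S. prank UNIV S = prank W T + 1" "- T ` W"]
      fix_part_inv v0_inv by (simp add: e3_def prank_ext_by)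
qed

end

theorem lemma3p3:
  fixes W :: "('a::{field,finite}^'n) set" and T :: "'a^'n \<Rightarrow> 'a^'n"
  assumes "vec.subspace W"
    and "vec.dim W + 1 = CARD('n)"
    and "plinear W T"
  shows "e2 W T (srk W T) = CARD('a) ^ srk W T * e2 W T (srk W T + 1) \<and>
         (\<not> T ` W \<subseteq> W \<longrightarrow>
           e3 W T (prank W T) (srk W T) = CARD('a) ^ srk W T * e3 W T (prank W T) (srk W T + 1) \<and>
           e3 W T (prank W T + 1) (srk W T) = CARD('a) ^ srk W T * e3 W T (prank W T + 1) (srk W T + 1))"
proof (cases "\<exists>S0. vec_linear S0 \<and> semi_idempotent S0 \<and> (\<forall>w\<in>W. S0 w = T w)")
  case True
  then obtain S0 where "vec_linear S0" "semi_idempotent S0" "\<forall>w\<in>W. S0 w = T w" by blast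
  then interpret finite_hyperplane_extension W T S0
    using assms(1,2)
    by (simp add: finite_hyperplane_extension_def hyperplane_extension_def hyperplane_def
        hyperplane_extension_axioms_def)
  show ?thesis using e2_srk e3_srk by blast
next
  case False
  then have no_extension:
    "{S. vec_linear S \<and> semi_idempotent S \<and> (\<forall>w\<in>W. S w = T w) \<and> P S} = {}" for P
    by blast
  show ?thesis unfolding e2_def e3_def no_extension by simp
qed

end
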